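(* Consider the dynamic matching model described in the context, with the relation $\succ_{\mathcal M_s}$ defined there (that is, $\succ_{\mathcal M}$ satisfies the modified Monge condition: whenever $(i,j)\succ_{\mathcal M}(i',j)$ and $(i,j)\succ_{\mathcal M}(i,j')$, then $r_{ij}^t+r_{i'j'}^t\ge r_{ij'}^t+r_{i'j}^t$ for all $t=1,\dots,T$; in this case $\succ_{\mathcal M}$ is denoted $\succ_{\mathcal M_s}$). Then there exists an optimal matching policy that respects $\succ_{\mathcal M_s}$.
   Context: Model. Let $T,m,n\ge 1$ be integers, $\alpha,\beta\in[0,1]$ the carry-over fractions of unmatched demand and supply, $\mathcal D=\{1,\dots,m\}$ the demand types, $\mathcal S=\{1,\dots,n\}$ the supply types (disjoint sets), and $r_{ij}^t\in\mathbb R$ ($i\in\mathcal D$, $j\in\mathcal S$, $1\le t\le T$) the unit matching rewards, with the convention $r_{ij}^{T+1}=0$. In each period $t$ random vectors $\mathbf D^t\in\mathbb R_+^m$, $\mathbf S^t\in\mathbb R_+^n$ of new demand and supply arrive; their distributions do not depend on matching decisions. The state $(\mathbf x,\mathbf y)\in\mathbb R_+^m\times\mathbb R_+^n$ in period $t$ lists the available quantities of each type after the arrivals of period $t$. A feasible decision in state $(\mathbf x,\mathbf y)$ is a matrix $\mathbf Q=(q_{ij})\in\mathbb R_+^{m\times n}$ whose post-matching levels $u_i=x_i-\sum_{j}q_{ij}$ and $v_j=y_j-\sum_{i}q_{ij}$ are all nonnegative. Put $V_{T+1}\equiv 0$ and, for $t=T,\dots,1$, $$H_t(\mathbf Q,\mathbf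 x,\mathbf y)=\sum_{i,j}r_{ij}^tq_{ij}+E\,V_{t+1}(\alpha\mathbf u+\mathbf D^{t+1},\beta\mathbf v+\mathbf S^{t+1}),\qquad V_t(\mathbf x,\mathbf y)=\max_{\mathbf Q\text{ feasible}}H_t(\mathbf Q,\mathbf x,\mathbf y).$$ A matching policy assigns to every $t$ and every state a feasible decision $\mathbf Q^t(\mathbf x,\mathbf y)=(q_{ij}^t)$; it is optimal if for every $t$ and every state the decision attains the maximum defining $V_t(\mathbf x,\mathbf y)$. Dominance. For $i\neq i'$, $(i,j)\succ_{\mathcal M}(i',j)$ means that for all $t=1,\dots,T$: $r_{ij}^t\ge r_{i'j}^t$, and $r_{ij}^t-r_{i'j}^t\ge\alpha(r_{ij''}^{t+1}-r_{i'j''}^{t+1})$ for all $j''\in\mathcal S$. For $j\ne j'$, $(i,j)\succ_{\mathcal M}(i,j')$ means that for all $t=1,\dots,T$: $r_{ij}^t\ge r_{ij'}^t$, and $r_{ij}^t-r_{ij'}^t\ge\beta(r_{i''j}^{t+1}-r_{i''j'}^{t+1})$ for all $i''\in\mathcal D$. Respecting. Let $\mathcal B_{ij,L}=\{(i,j'): j'\ne j,\ (i,j)\succ_{\mathcal M_s}(i,j')\}$ and $\mathcal B_{ij,R}=\{(i',j): i'\neq i,\ (i,j)\succ_{\mathcal M_s}(i',j)\}$. For a pair $(i,j)$, period $t$, state $(\mathbf x,\mathbf y)$ and decision $(q^t_{ij})$ put $a_i^t=x_i-\sum_{j'':(i,j'')\notin\mathcal B_{ij,L}}q_{ij''}^t$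 and $b_j^t=y_j-\sum_{i'':(i'',j)\notin\mathcal B_{ij,R}}q_{i''j}^t$ (both depend on the pair $(i,j)$). An optimal policy respects $\succ_{\mathcal M_s}$ if in every period $t=1,\dots,T$ and every state: (i) for all $(i,j)\succ_{\mathcal M_s}(i',j)$, either $q_{i'j}^t=0$ or $a_i^t=0$; (ii) for all $(i,j)\succ_{\mathcal M_s}(i,j')$, either $q_{ij'}^t=0$ or $b_j^t=0$.
   Formalization: The dominance relation is taken strictly throughout (one pair dominates another and not conversely), also in the Monge condition, the sets B and respecting; with mutual dominance the literal claim fails, e.g. T=1, two demand types, one supply type, equal rewards 1. *)

theory Defs
  imports "HOL-Probability.Probability"
begin

type_synonym ('m, 'n) decision = "real ^ 'n ^ 'm"

definition nonneg_vec :: "real ^ 'k \<Rightarrow> bool" where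
  "nonneg_vec x \<longleftrightarrow> (\<forall>i. 0 \<le> x $ i)"

definition post_demand :: "('m::finite, 'n::finite) decision \<Rightarrow> real ^ 'm \<Rightarrow> real ^ 'm" where
  "post_demand Q x = (\<chi> i. x $ i - (\<Sum>j\<in>UNIV. Q $ i $ j))"

definition post_supply :: "('m::finite, 'n::finite) decision \<Rightarrow> real ^ 'n \<Rightarrow> real ^ 'n" where
  "post_supply Q y = (\<chi> j. y $ j - (\<Sum>i\<in>UNIV. Q $ i $ j))"

definition feasible :: "real ^ 'm \<Rightarrow> real ^ 'n \<Rightarrow> ('m::finite, 'n::finite) decision set" where
  "feasible x y =
    {Q. (\<forall>i j. 0 \<le> Q $ i $ j) \<and> nonneg_vec (post_demand Q x) \<and> nonneg_vec (post_supply Q y)}"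

text \<open>
  The demand types are the elements of the finite type \<open>'m\<close>, the supply types those of \<open>'n\<close>.
  Arrivals of different periods, and demand and supply of the same period, may be dependent: the
  recursion for the value function only involves the joint law of the arrivals of each period.
\<close>

locale dynamic_matching = prob_space M
  for M :: "'w measure" +
  fixes T :: nat
    and \<alpha> \<beta> :: real
    and r :: "nat \<Rightarrow> 'm::finite \<Rightarrow> 'n::finite \<Rightarrow> real"
    and D :: "nat \<Rightarrow> 'w \<Rightarrow> real ^ 'm"
    and S :: "nat \<Rightarrow> 'w \<Rightarrow> real ^ 'n"
  assumes T_ge_1: "1 \<le> T"
    and alpha_range: "\<alpha> \<in> {0..1}"
    and beta_range: "\<beta> \<in> {0..1}"
    and r_terminal: "\<And>i j. r (T + 1) i j = 0"
    and D_measurable: "\<And>t. t \<in> {1..T} \<Longrightarrow> random_variable borel (D t)"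
    and S_measurable: "\<And>t. t \<in> {1..T} \<Longrightarrow> random_variable borel (S t)"
    and D_nonneg: "\<And>t \<omega>. t \<in> {1..T} \<Longrightarrow> \<omega> \<in> space M \<Longrightarrow> nonneg_vec (D t \<omega>)"
    and S_nonneg: "\<And>t \<omega>. t \<in> {1..T} \<Longrightarrow> \<omega> \<in> space M \<Longrightarrow> nonneg_vec (S t \<omega>)"
begin

text \<open>\<open>W\<close> is the value function of the next period.\<close>

definition stage_value ::
  "(real ^ 'm \<Rightarrow> real ^ 'n \<Rightarrow> real) \<Rightarrow> nat \<Rightarrow> ('m, 'n) decision \<Rightarrow> real ^ 'm \<Rightarrow> real ^ 'n \<Rightarrow> real"
where
  "stage_value W t Q x y =
    (\<Sum>i\<in>UNIV. \<Sum>j\<in>UNIV. r t i j * Q $ i $ j)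
    + expectation (\<lambda>\<omega>. W (\<alpha> *\<^sub>R post_demand Q x + D (t + 1) \<omega>)
                         (\<beta> *\<^sub>R post_supply Q y + S (t + 1) \<omega>))"

text \<open>
  \<open>V_to_go k\<close> is the value function with \<open>k\<close> periods to go, i.e. that of period \<open>T + 1 - k\<close>.
  The maximum over feasible decisions is written as a supremum; it is attained as soon as an
  \<open>optimal_policy\<close> (defined below) exists. Finite means of the arrivals, which make the
  expectations finite, are not assumed; where the integrand is not integrable, \<open>expectation\<close>
  is 0 by convention.
\<close>

primrec V_to_go :: "nat \<Rightarrow> real ^ 'm \<Rightarrow> real ^ 'n \<Rightarrow> real" where
  "V_to_go 0 = (\<lambda>x y. 0)"
| "V_to_go (Suc k) =
    (\<lambda>x y. SUP Q\<in>feasible x y. stage_value (V_to_go k) (T - k) Q x y)"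

definition V :: "nat \<Rightarrow> real ^ 'm \<Rightarrow> real ^ 'n \<Rightarrow> real" where
  "V t = V_to_go (T + 1 - t)"

definition H :: "nat \<Rightarrow> ('m, 'n) decision \<Rightarrow> real ^ 'm \<Rightarrow> real ^ 'n \<Rightarrow> real" where
  "H t = stage_value (V (t + 1)) t"

lemma V_terminal: "V (T + 1) x y = 0"
  by (simp add: V_def)

lemma V_rec:
  assumes "t \<in> {1..T}"
  shows "V t x y = (SUP Q\<in>feasible x y. H t Q x y)"
proof -
  have "T + 1 - t = Suc (T - t)" "T + 1 - (t + 1) = T - t" "T - (T - t) = t"
    using assms by auto
  then show ?thesis by (simp add: V_def H_def)
qed

definition matching_policy :: "(nat \<Rightarrow> real ^ 'm \<Rightarrow> real ^ 'n \<Rightarrow> ('m, 'n) decision) \<Rightarrow> bool" where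
  "matching_policy q \<longleftrightarrow>
    (\<forall>t\<in>{1..T}. \<forall>x y. nonneg_vec x \<longrightarrow> nonneg_vec y \<longrightarrow> q t x y \<in> feasible x y)"

definition optimal_policy :: "(nat \<Rightarrow> real ^ 'm \<Rightarrow> real ^ 'n \<Rightarrow> ('m, 'n) decision) \<Rightarrow> bool" where
  "optimal_policy q \<longleftrightarrow> matching_policy q \<and>
    (\<forall>t\<in>{1..T}. \<forall>x y. nonneg_vec x \<longrightarrow> nonneg_vec y \<longrightarrow>
      (\<forall>Q\<in>feasible x y. H t Q x y \<le> H t (q t x y) x y))"

definition weakly_dominates :: "'m \<times> 'n \<Rightarrow> 'm \<times> 'n \<Rightarrow> bool" where
  "weakly_dominates = (\<lambda>(i, j) (i', j').
    (i \<noteq> i' \<and> j = j' \<and>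
      (\<forall>t\<in>{1..T}. r t i j \<ge> r t i' j \<and>
        (\<forall>j''. r t i j - r t i' j \<ge> \<alpha> * (r (t + 1) i j'' - r (t + 1) i' j'')))) \<or>
    (i = i' \<and> j \<noteq> j' \<and>
      (\<forall>t\<in>{1..T}. r t i j \<ge> r t i j' \<and>
        (\<forall>i''. r t i j - r t i j' \<ge> \<beta> * (r (t + 1) i'' j - r (t + 1) i'' j')))))"

text \<open>
  The inequalities of \<^const>\<open>weakly_dominates\<close> are not strict, so two pairs can dominate each
  other. The order used below is the strict one, without such ties. It coincides with
  \<^const>\<open>weakly_dominates\<close> whenever no two pairs dominate each other. Ties have to be left out: for
  one period, two demand types, one supply type, both rewards equal to 1, and one unit of each type
  available, an optimal decision satisfies \<open>q\<^sub>1 + q\<^sub>2 = 1\<close>, whereas respecting both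
  directions of the tie would demand \<open>q\<^sub>2 = 0 \<or> q\<^sub>1 = 1\<close> and \<open>q\<^sub>1 = 0 \<or> q\<^sub>2 = 1\<close>, which is
  impossible.
\<close>

definition dominates :: "'m \<times> 'n \<Rightarrow> 'm \<times> 'n \<Rightarrow> bool" (infix "\<succ>" 50) where
  "p \<succ> p' \<longleftrightarrow> weakly_dominates p p' \<and> \<not> weakly_dominates p' p"

definition modified_Monge :: bool where
  "modified_Monge \<longleftrightarrow>
    (\<forall>i i' j j'. (i, j) \<succ> (i', j) \<longrightarrow> (i, j) \<succ> (i, j') \<longrightarrow>
      (\<forall>t\<in>{1..T}. r t i j + r t i' j' \<ge> r t i j' + r t i' j))"

definition B_L :: "'m \<Rightarrow> 'n \<Rightarrow> ('m \<times> 'n) set" where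
  "B_L i j = {(i, j') | j'. j' \<noteq> j \<and> (i, j) \<succ> (i, j')}"

definition B_R :: "'m \<Rightarrow> 'n \<Rightarrow> ('m \<times> 'n) set" where
  "B_R i j = {(i', j) | i'. i' \<noteq> i \<and> (i, j) \<succ> (i', j)}"

definition a_level :: "'m \<Rightarrow> 'n \<Rightarrow> ('m, 'n) decision \<Rightarrow> real ^ 'm \<Rightarrow> real" where
  "a_level i j Q x = x $ i - (\<Sum>j''\<in>{j''. (i, j'') \<notin> B_L i j}. Q $ i $ j'')"

definition b_level :: "'m \<Rightarrow> 'n \<Rightarrow> ('m, 'n) decision \<Rightarrow> real ^ 'n \<Rightarrow> real" where
  "b_level i j Q y = y $ j - (\<Sum>i''\<in>{i''. (i'', j) \<notin> B_R i j}. Q $ i'' $ j)"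

definition respects_dominance :: "(nat \<Rightarrow> real ^ 'm \<Rightarrow> real ^ 'n \<Rightarrow> ('m, 'n) decision) \<Rightarrow> bool" where
  "respects_dominance q \<longleftrightarrow>
    (\<forall>t\<in>{1..T}. \<forall>x y. nonneg_vec x \<longrightarrow> nonneg_vec y \<longrightarrow>
      (\<forall>i i' j. (i, j) \<succ> (i', j) \<longrightarrow>
        q t x y $ i' $ j = 0 \<or> a_level i j (q t x y) x = 0) \<and>
      (\<forall>i j j'. (i, j) \<succ> (i, j') \<longrightarrow>
        q t x y $ i $ j' = 0 \<or> b_level i j (q t x y) y = 0))"

end

end

theory Submission
  imports Defs
begin

text \<open>
  Fix a period and a state. Among the decisions that maximise \<open>H\<close>, take one that also maximises a
  suitable linear functional \<open>\<Sum> w\<^sub>i\<^sub>j q\<^sub>i\<^sub>j\<close>. A violation of the dominance relation in that decision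
  could be repaired by a small exchange that does not decrease \<open>H\<close> but increases the functional,
  a contradiction. Condition (i) is violated at \<open>(i, j) \<succ> (i', j)\<close> when \<open>q\<^sub>i\<^sub>'\<^sub>j > 0\<close> and either type
  \<open>i\<close> has an unmatched remainder or \<open>q\<^sub>i\<^sub>j\<^sub>' > 0\<close> for some \<open>(i, j) \<succ> (i, j')\<close>; so there are two
  exchanges (\<open>exchange_improves_weight\<close>).

  If \<open>i\<close> has a remainder, \<open>e\<close> units of \<open>j\<close> are moved from \<open>i'\<close> to \<open>i\<close>. The immediate gain is
  \<open>e (r\<^sub>i\<^sub>j - r\<^sub>i\<^sub>'\<^sub>j)\<close>, and the next period starts with \<open>\<alpha> e\<close> more of \<open>i'\<close> instead of \<open>i\<close>. This
  replacement costs at most the gain (\<open>tail_demand_swap\<close>): starting from the worse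
  state, one can imitate the optimal decisions of the better one and use \<open>i'\<close> wherever the extra
  units of \<open>i\<close> would have been used. A unit first matched \<open>k\<close> periods later, to \<open>j''\<close>, costs
  \<open>\<alpha>\<^sup>k (r\<^sub>i\<^sub>j\<^sub>'\<^sub>' - r\<^sub>i\<^sub>'\<^sub>j\<^sub>'\<^sub>')\<close> with the rewards of that later period, and
  chaining the inequalities of the dominance relation bounds this by the present \<open>r\<^sub>i\<^sub>j - r\<^sub>i\<^sub>'\<^sub>j\<close>.

  Otherwise \<open>e\<close> units are moved from \<open>(i, j')\<close> and \<open>(i', j)\<close> to \<open>(i, j)\<close> and \<open>(i', j')\<close>. No
  remainder changes, and the modified Monge condition says that no reward is lost.

  Both exchanges increase the functional when \<open>w\<close> is positive and at least doubles along \<open>\<succ>\<close>.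
  Such weights exist because \<open>\<succ>\<close>, although not transitive in general, has no cycles
  (\<open>exists_doubling_weight\<close>).

  Condition (ii) is condition (i) for the model with demand and supply interchanged. Maxima are
  attained because the value functions are Lipschitz on the nonnegative orthants; this also makes
  the next value integrable either for all states and decisions of a period or for none,
  so that the conventional value 0 of a divergent expectation does no harm.
\<close>

section \<open>One-period problems\<close>

definition weighted_total :: "('m::finite \<Rightarrow> 'n::finite \<Rightarrow> real) \<Rightarrow> ('m, 'n) decision \<Rightarrow> real" where
  "weighted_total w Q = (\<Sum>i\<in>UNIV. \<Sum>j\<in>UNIV. w i j * Q $ i $ j)"

definition one_period ::
  "('m::finite \<Rightarrow> 'n::finite \<Rightarrow> real) \<Rightarrow> (real ^ 'm \<Rightarrow> real ^ 'n \<Rightarrow> real) \<Rightarrow>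
    ('m, 'n) decision \<Rightarrow> real ^ 'm \<Rightarrow> real ^ 'n \<Rightarrow> real" where
  "one_period c G Q x y = weighted_total c Q + G (post_demand Q x) (post_supply Q y)"

text \<open>
  In the \<open>\<ell>\<^sub>1\<close> distance, row and column sums of a decision change by at most as much as its entries.
  One inequality gives a two-sided estimate since the two states may be interchanged.
\<close>

definition orthant_lipschitz :: "real \<Rightarrow> (real ^ 'm::finite \<Rightarrow> real ^ 'n::finite \<Rightarrow> real) \<Rightarrow> bool" where
  "orthant_lipschitz L W \<longleftrightarrow> 0 \<le> L \<and>
    (\<forall>x y x' y'. nonneg_vec x \<longrightarrow> nonneg_vec y \<longrightarrow> nonneg_vec x' \<longrightarrow> nonneg_vec y' \<longrightarrow>
      W x y \<le> W x' y' + L * ((\<Sum>i\<in>UNIV. \<bar>x $ i - x' $ i\<bar>) + (\<Sum>j\<in>UNIV. \<bar>y $ j - y' $ j\<bar>)))"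

lemma orthant_lipschitzD:
  assumes "orthant_lipschitz L W" "nonneg_vec x" "nonneg_vec y" "nonneg_vec x'" "nonneg_vec y'"
  shows "W x y \<le> W x' y' + L * ((\<Sum>i\<in>UNIV. \<bar>x $ i - x' $ i\<bar>) + (\<Sum>j\<in>UNIV. \<bar>y $ j - y' $ j\<bar>))"
  using assms unfolding orthant_lipschitz_def by blast

lemma orthant_lipschitz_const: "orthant_lipschitz 0 (\<lambda>x y. c)"
  by (simp add: orthant_lipschitz_def)

lemma orthant_lipschitz_imp_continuous_on:
  fixes W :: "real ^ 'm::finite \<Rightarrow> real ^ 'n::finite \<Rightarrow> real"
  assumes W: "orthant_lipschitz L W"
  shows "continuous_on {(x, y). nonneg_vec x \<and> nonneg_vec y} (\<lambda>(x, y). W x y)"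
proof -
  let ?K = "L * (real CARD('m) + real CARD('n))"
  have L: "0 \<le> L" using W by (simp add: orthant_lipschitz_def)
  have le: "W x y - W x' y' \<le> ?K * dist (x, y) (x', y')"
    if "nonneg_vec x" "nonneg_vec y" "nonneg_vec x'" "nonneg_vec y'" for x x' y y'
  proof -
    have "(\<Sum>i\<in>UNIV. \<bar>x $ i - x' $ i\<bar>) \<le> (\<Sum>i\<in>(UNIV::'m set). dist (x, y) (x', y'))"
    proof (rule sum_mono)
      fix i
      have "\<bar>x $ i - x' $ i\<bar> \<le> dist x x'"
        using component_le_norm_cart[of "x - x'" i] by (simp add: dist_norm)
      also have "\<dots> \<le> dist (x, y) (x', y')" using dist_fst_le[of "(x, y)" "(x', y')"] by simp
      finally show "\<bar>x $ i - x' $ i\<bar> \<le> dist (x, y) (x', y')" .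
    qed
    moreover have "(\<Sum>j\<in>UNIV. \<bar>y $ j - y' $ j\<bar>) \<le> (\<Sum>j\<in>(UNIV::'n set). dist (x, y) (x', y'))"
    proof (rule sum_mono)
      fix j
      have "\<bar>y $ j - y' $ j\<bar> \<le> dist y y'"
        using component_le_norm_cart[of "y - y'" j] by (simp add: dist_norm)
      also have "\<dots> \<le> dist (x, y) (x', y')" using dist_snd_le[of "(x, y)" "(x', y')"] by simp
      finally show "\<bar>y $ j - y' $ j\<bar> \<le> dist (x, y) (x', y')" .
    qed
    ultimately have "(\<Sum>i\<in>UNIV. \<bar>x $ i - x' $ i\<bar>) + (\<Sum>j\<in>UNIV. \<bar>y $ j - y' $ j\<bar>)
        \<le> (real CARD('m) + real CARD('n)) * dist (x, y) (x', y')"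
      by (simp add: distrib_right)
    from mult_left_mono[OF this L] orthant_lipschitzD[OF W that]
    show ?thesis by (simp add: mult.assoc)
  qed
  have "?K-lipschitz_on {(x, y). nonneg_vec x \<and> nonneg_vec y} (\<lambda>(x, y). W x y)"
  proof (rule lipschitz_onI)
    fix p p' :: "(real ^ 'm) \<times> (real ^ 'n)"
    assume "p \<in> {(x, y). nonneg_vec x \<and> nonneg_vec y}" "p' \<in> {(x, y). nonneg_vec x \<and> nonneg_vec y}"
    then show "dist (case p of (x, y) \<Rightarrow> W x y) (case p' of (x, y) \<Rightarrow> W x y) \<le> ?K * dist p p'"
      using le[of "fst p" "snd p" "fst p'" "snd p'"] le[of "fst p'" "snd p'" "fst p" "snd p"]
      by (auto simp: dist_real_def abs_if dist_commute split: prod.splits)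
  qed (use L in simp)
  then show ?thesis by (rule lipschitz_on_continuous_on)
qed

lemma post_demand_nth [simp]: "post_demand Q x $ i = x $ i - (\<Sum>j\<in>UNIV. Q $ i $ j)"
  by (simp add: post_demand_def)

lemma post_supply_nth [simp]: "post_supply Q y $ j = y $ j - (\<Sum>i\<in>UNIV. Q $ i $ j)"
  by (simp add: post_supply_def)

lemma mem_feasible_iff:
  "Q \<in> feasible x y \<longleftrightarrow> (\<forall>i j. 0 \<le> Q $ i $ j) \<and>
    (\<forall>i. (\<Sum>j\<in>UNIV. Q $ i $ j) \<le> x $ i) \<and> (\<forall>j. (\<Sum>i\<in>UNIV. Q $ i $ j) \<le> y $ j)"
  by (simp add: feasible_def nonneg_vec_def)

lemma nonneg_vec_add_scaled:
  "0 \<le> a \<Longrightarrow> nonneg_vec u \<Longrightarrow> nonneg_vec d \<Longrightarrow> nonneg_vec (a *\<^sub>R u + d)"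
  by (simp add: nonneg_vec_def)

lemma compact_feasible: "compact (feasible x y :: ('m::finite, 'n::finite) decision set)"
proof -
  have "feasible x y =
      (\<Inter>i j. {Q :: ('m, 'n) decision. 0 \<le> Q $ i $ j}) \<inter>
      (\<Inter>i. {Q. (\<Sum>j\<in>UNIV. Q $ i $ j) \<le> x $ i}) \<inter> (\<Inter>j. {Q. (\<Sum>i\<in>UNIV. Q $ i $ j) \<le> y $ j})"
    by (auto simp: mem_feasible_iff)
  moreover have "closed \<dots>"
    by (intro closed_Int closed_INT ballI closed_Collect_le continuous_intros)
  ultimately have "closed (feasible x y :: ('m, 'n) decision set)" by simp
  moreover have "bounded (feasible x y :: ('m, 'n) decision set)"
  proof (rule boundedI)
    fix Q :: "('m, 'n) decision" assume Q: "Q \<in> feasible x y"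
    have "norm Q \<le> (\<Sum>i\<in>UNIV. norm (Q $ i))"
      unfolding norm_vec_def[of Q] by (rule L2_set_le_sum) simp
    also have "\<dots> \<le> (\<Sum>i\<in>UNIV. x $ i)"
    proof (rule sum_mono)
      fix i
      have "norm (Q $ i) \<le> (\<Sum>j\<in>UNIV. \<bar>Q $ i $ j\<bar>)" by (rule norm_le_l1_cart)
      then show "norm (Q $ i) \<le> x $ i"
        using Q order_trans by (simp add: mem_feasible_iff) blast
    qed
    finally show "norm Q \<le> (\<Sum>i\<in>UNIV. x $ i)" .
  qed
  ultimately show ?thesis by (simp add: compact_eq_bounded_closed)
qed

lemma zero_feasible: "nonneg_vec x \<Longrightarrow> nonneg_vec y \<Longrightarrow> 0 \<in> feasible x y"
  by (simp add: mem_feasible_iff nonneg_vec_def)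

lemma continuous_on_weighted_total: "continuous_on A (weighted_total w)"
  unfolding weighted_total_def by (intro continuous_intros)

lemma continuous_on_one_period:
  assumes "orthant_lipschitz L G"
  shows "continuous_on (feasible x y) (\<lambda>Q. one_period c G Q x y)"
proof -
  have "continuous_on (feasible x y) (\<lambda>Q. (post_demand Q x, post_supply Q y))"
    unfolding post_demand_def post_supply_def by (intro continuous_intros)
  then have "continuous_on (feasible x y)
      (\<lambda>Q. (\<lambda>(u, v). G u v) (post_demand Q x, post_supply Q y))"
    by (rule continuous_on_compose2[OF orthant_lipschitz_imp_continuous_on[OF assms]])
       (auto simp: feasible_def)
  then show ?thesis
    unfolding one_period_def by (simp add: continuous_on_add continuous_on_weighted_total)
qed

lemma one_period_attains_max:
  assumes "orthant_lipschitz L G" "nonneg_vec x" "nonneg_vec y"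
  obtains Q where "Q \<in> feasible x y"
    "\<And>Q'. Q' \<in> feasible x y \<Longrightarrow> one_period c G Q' x y \<le> one_period c G Q x y"
  using continuous_attains_sup[OF compact_feasible _ continuous_on_one_period[OF assms(1)]]
    zero_feasible[OF assms(2,3)] by (metis empty_iff)

lemma one_period_le_SUP:
  assumes "orthant_lipschitz L G" "Q \<in> feasible x y"
  shows "one_period c G Q x y \<le> (SUP Q\<in>feasible x y. one_period c G Q x y)"
proof (rule cSUP_upper[OF assms(2)])
  show "bdd_above ((\<lambda>Q. one_period c G Q x y) ` feasible x y)"
    by (intro bounded_imp_bdd_above compact_imp_bounded compact_continuous_image
        compact_feasible continuous_on_one_period[OF assms(1)])
qed

text \<open>
  Multiplying the rows of a decision by these factors adapts it from the levels \<open>x\<close> to the levels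
  \<open>x'\<close>, at a cost in row \<open>i\<close> of at most the difference of the two levels.
\<close>

lemma scaling_factors:
  fixes x x' :: "real ^ 'k::finite"
  assumes "nonneg_vec x" "nonneg_vec x'"
  obtains l where "\<And>i. 0 \<le> l i" "\<And>i. l i \<le> 1" "\<And>i. l i * x $ i \<le> x' $ i"
    "\<And>i. (1 - l i) * x $ i \<le> \<bar>x $ i - x' $ i\<bar>"
proof -
  have "\<exists>l. 0 \<le> l \<and> l \<le> 1 \<and> l * x $ i \<le> x' $ i \<and> (1 - l) * x $ i \<le> \<bar>x $ i - x' $ i\<bar>" for i
  proof (cases "x $ i \<le> x' $ i")
    case True
    then show ?thesis by (intro exI[of _ 1]) simp
  next
    case False
    moreover have "0 \<le> x $ i" "0 \<le> x' $ i" using assms by (auto simp: nonneg_vec_def)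
    ultimately show ?thesis by (intro exI[of _ "x' $ i / x $ i"]) (simp add: field_simps)
  qed
  then show thesis using that by metis
qed

text \<open>
  Feasible sets vary Lipschitz-continuously with the state. Rows and columns are
  scaled by factors \<open>l i\<close> and \<open>k j\<close>, and \<open>1 - l i * k j \<le> (1 - l i) + (1 - k j)\<close> separates the
  two effects.
\<close>

lemma feasible_transport:
  fixes Q :: "('m::finite, 'n::finite) decision"
  assumes Q: "Q \<in> feasible x y" and "nonneg_vec x" "nonneg_vec y" "nonneg_vec x'" "nonneg_vec y'"
  obtains Q' where "Q' \<in> feasible x' y'"
    "(\<Sum>i\<in>UNIV. \<Sum>j\<in>UNIV. \<bar>Q $ i $ j - Q' $ i $ j\<bar>)
      \<le> (\<Sum>i\<in>UNIV. \<bar>x $ i - x' $ i\<bar>) + (\<Sum>j\<in>UNIV. \<bar>y $ j - y' $ j\<bar>)"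
proof -
  obtain l where l: "\<And>i. 0 \<le> l i" "\<And>i. l i \<le> 1" "\<And>i. l i * x $ i \<le> x' $ i"
    "\<And>i. (1 - l i) * x $ i \<le> \<bar>x $ i - x' $ i\<bar>" using scaling_factors[of x x'] assms by metis
  obtain k where k: "\<And>j. 0 \<le> k j" "\<And>j. k j \<le> 1" "\<And>j. k j * y $ j \<le> y' $ j"
    "\<And>j. (1 - k j) * y $ j \<le> \<bar>y $ j - y' $ j\<bar>" using scaling_factors[of y y'] assms by metis
  define Q' :: "('m, 'n) decision" where "Q' = (\<chi> i j. l i * k j * Q $ i $ j)"
  have nn: "0 \<le> Q $ i $ j" for i j using Q by (simp add: mem_feasible_iff)
  have row: "(\<Sum>j\<in>UNIV. Q $ i $ j) \<le> x $ i" for i using Q by (simp add: mem_feasible_iff)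
  have col: "(\<Sum>i\<in>UNIV. Q $ i $ j) \<le> y $ j" for j using Q by (simp add: mem_feasible_iff)
  have "(\<Sum>j\<in>UNIV. Q' $ i $ j) \<le> x' $ i" for i
  proof -
    have "(\<Sum>j\<in>UNIV. Q' $ i $ j) \<le> (\<Sum>j\<in>UNIV. l i * Q $ i $ j)"
      unfolding Q'_def using l k nn
      by (intro sum_mono) (simp add: mult_left_le mult_left_mono mult_right_mono)
    also have "\<dots> \<le> l i * x $ i" using l row by (simp flip: sum_distrib_left add: mult_left_mono)
    finally show ?thesis using l(3)[of i] by simp
  qed
  moreover have "(\<Sum>i\<in>UNIV. Q' $ i $ j) \<le> y' $ j" for j
  proof -
    have "(\<Sum>i\<in>UNIV. Q' $ i $ j) \<le> (\<Sum>i\<in>UNIV. k j * Q $ i $ j)"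
      unfolding Q'_def using l k nn
      by (intro sum_mono) (simp add: mult_left_le_one_le mult_right_mono)
    also have "\<dots> \<le> k j * y $ j" using k col by (simp flip: sum_distrib_left add: mult_left_mono)
    finally show ?thesis using k(3)[of j] by simp
  qed
  ultimately have "Q' \<in> feasible x' y'" by (simp add: mem_feasible_iff Q'_def l k nn)
  moreover have "(\<Sum>i\<in>UNIV. \<Sum>j\<in>UNIV. \<bar>Q $ i $ j - Q' $ i $ j\<bar>)
      \<le> (\<Sum>i\<in>UNIV. \<bar>x $ i - x' $ i\<bar>) + (\<Sum>j\<in>UNIV. \<bar>y $ j - y' $ j\<bar>)"
  proof -
    have "\<bar>Q $ i $ j - Q' $ i $ j\<bar> \<le> (1 - l i) * Q $ i $ j + (1 - k j) * Q $ i $ j" for i j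
    proof -
      have "l i * k j \<le> 1" using l k by (simp add: mult_le_one)
      then have "l i * k j * Q $ i $ j \<le> Q $ i $ j"
        using nn[of i j] l(1)[of i] k(1)[of j] by (simp add: mult_left_le_one_le)
      moreover have "0 \<le> (1 - l i) * (1 - k j) * Q $ i $ j" using l k nn by simp
      ultimately show ?thesis by (simp add: Q'_def algebra_simps)
    qed
    then have "(\<Sum>i\<in>UNIV. \<Sum>j\<in>UNIV. \<bar>Q $ i $ j - Q' $ i $ j\<bar>)
        \<le> (\<Sum>i\<in>UNIV. \<Sum>j\<in>UNIV. (1 - l i) * Q $ i $ j + (1 - k j) * Q $ i $ j)"
      by (intro sum_mono)
    also have "\<dots> = (\<Sum>i\<in>UNIV. (1 - l i) * (\<Sum>j\<in>UNIV. Q $ i $ j))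
        + (\<Sum>i\<in>UNIV. \<Sum>j\<in>UNIV. (1 - k j) * Q $ i $ j)"
      by (simp add: sum.distrib sum_distrib_left)
    also have "(\<Sum>i\<in>UNIV. \<Sum>j\<in>UNIV. (1 - k j) * Q $ i $ j)
        = (\<Sum>j\<in>UNIV. (1 - k j) * (\<Sum>i\<in>UNIV. Q $ i $ j))"
      by (subst sum.swap) (simp add: sum_distrib_left)
    also have "(\<Sum>i\<in>UNIV. (1 - l i) * (\<Sum>j\<in>UNIV. Q $ i $ j)) \<le> (\<Sum>i\<in>UNIV. \<bar>x $ i - x' $ i\<bar>)"
      using mult_left_mono[OF row] l by (intro sum_mono order_trans[OF _ l(4)]) simp
    also have "(\<Sum>j\<in>UNIV. (1 - k j) * (\<Sum>i\<in>UNIV. Q $ i $ j)) \<le> (\<Sum>j\<in>UNIV. \<bar>y $ j - y' $ j\<bar>)"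
      using mult_left_mono[OF col] k by (intro sum_mono order_trans[OF _ k(4)]) simp
    finally show ?thesis by simp
  qed
  ultimately show thesis using that by blast
qed

text \<open>
  A decision transported to a state at distance \<open>d\<close> loses at most \<open>C * d\<close> in rewards. Each of the two
  post-matching vectors moves by the move of the state and of the decision, which makes \<open>3 * d\<close>
  in total.
\<close>

lemma one_period_value_lipschitz:
  fixes c :: "'m::finite \<Rightarrow> 'n::finite \<Rightarrow> real"
  assumes G: "orthant_lipschitz L G"
  shows "\<exists>L'. orthant_lipschitz L' (\<lambda>x y. SUP Q\<in>feasible x y. one_period c G Q x y)"
proof -
  have L: "0 \<le> L" using G by (simp add: orthant_lipschitz_def)
  define C where "C = (\<Sum>i\<in>UNIV. \<Sum>j\<in>UNIV. \<bar>c i j\<bar>)"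
  have "\<bar>c i j\<bar> \<le> (\<Sum>j\<in>UNIV. \<bar>c i j\<bar>)" for i j by (rule member_le_sum) auto
  moreover have "(\<Sum>j\<in>UNIV. \<bar>c i j\<bar>) \<le> C" for i
    unfolding C_def by (rule member_le_sum[where f = "\<lambda>i. \<Sum>j\<in>UNIV. \<bar>c i j\<bar>"]) (auto intro: sum_nonneg)
  ultimately have c: "\<bar>c i j\<bar> \<le> C" for i j using order_trans by blast
  have C: "0 \<le> C" unfolding C_def by (intro sum_nonneg) simp
  have "orthant_lipschitz (C + 3 * L) (\<lambda>x y. SUP Q\<in>feasible x y. one_period c G Q x y)"
    unfolding orthant_lipschitz_def
  proof (intro conjI allI impI)
    show "0 \<le> C + 3 * L" using C L by simp
    fix x x' :: "real ^ 'm" and y y' :: "real ^ 'n"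
    assume nn: "nonneg_vec x" "nonneg_vec y" "nonneg_vec x'" "nonneg_vec y'"
    define d where "d = (\<Sum>i\<in>UNIV. \<bar>x $ i - x' $ i\<bar>) + (\<Sum>j\<in>UNIV. \<bar>y $ j - y' $ j\<bar>)"
    have "one_period c G Q x y \<le> (SUP Q\<in>feasible x' y'. one_period c G Q x' y') + (C + 3 * L) * d"
      if Q: "Q \<in> feasible x y" for Q
    proof -
      obtain Q' where Q': "Q' \<in> feasible x' y'"
        and Qd: "(\<Sum>i\<in>UNIV. \<Sum>j\<in>UNIV. \<bar>Q $ i $ j - Q' $ i $ j\<bar>) \<le> d"
        unfolding d_def by (rule feasible_transport[OF Q nn])
      have "weighted_total c Q - weighted_total c Q'
          = (\<Sum>i\<in>UNIV. \<Sum>j\<in>UNIV. c i j * (Q $ i $ j - Q' $ i $ j))"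
        by (simp add: weighted_total_def algebra_simps sum_subtractf)
      also have "\<dots> \<le> (\<Sum>i\<in>UNIV. \<Sum>j\<in>UNIV. C * \<bar>Q $ i $ j - Q' $ i $ j\<bar>)"
      proof (intro sum_mono)
        fix i j
        have "c i j * (Q $ i $ j - Q' $ i $ j) \<le> \<bar>c i j\<bar> * \<bar>Q $ i $ j - Q' $ i $ j\<bar>"
          by (metis abs_ge_self abs_mult)
        also have "\<dots> \<le> C * \<bar>Q $ i $ j - Q' $ i $ j\<bar>" using c by (simp add: mult_right_mono)
        finally show "c i j * (Q $ i $ j - Q' $ i $ j) \<le> C * \<bar>Q $ i $ j - Q' $ i $ j\<bar>" .
      qed
      also have "\<dots> = C * (\<Sum>i\<in>UNIV. \<Sum>j\<in>UNIV. \<bar>Q $ i $ j - Q' $ i $ j\<bar>)"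
        by (simp add: sum_distrib_left)
      also have "\<dots> \<le> C * d" using Qd C by (rule mult_left_mono)
      finally have 1: "weighted_total c Q \<le> weighted_total c Q' + C * d" by simp
      have "(\<Sum>i\<in>UNIV. \<bar>post_demand Q x $ i - post_demand Q' x' $ i\<bar>)
          \<le> (\<Sum>i\<in>UNIV. \<bar>x $ i - x' $ i\<bar> + (\<Sum>j\<in>UNIV. \<bar>Q $ i $ j - Q' $ i $ j\<bar>))"
      proof (rule sum_mono)
        fix i
        have "\<bar>(\<Sum>j\<in>UNIV. Q $ i $ j) - (\<Sum>j\<in>UNIV. Q' $ i $ j)\<bar> \<le> (\<Sum>j\<in>UNIV. \<bar>Q $ i $ j - Q' $ i $ j\<bar>)"
          by (simp flip: sum_subtractf)
        then show "\<bar>post_demand Q x $ i - post_demand Q' x' $ i\<bar>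
            \<le> \<bar>x $ i - x' $ i\<bar> + (\<Sum>j\<in>UNIV. \<bar>Q $ i $ j - Q' $ i $ j\<bar>)" by simp
      qed
      moreover have "(\<Sum>j\<in>UNIV. \<bar>post_supply Q y $ j - post_supply Q' y' $ j\<bar>)
          \<le> (\<Sum>j\<in>UNIV. \<bar>y $ j - y' $ j\<bar> + (\<Sum>i\<in>UNIV. \<bar>Q $ i $ j - Q' $ i $ j\<bar>))"
      proof (rule sum_mono)
        fix j
        have "\<bar>(\<Sum>i\<in>UNIV. Q $ i $ j) - (\<Sum>i\<in>UNIV. Q' $ i $ j)\<bar> \<le> (\<Sum>i\<in>UNIV. \<bar>Q $ i $ j - Q' $ i $ j\<bar>)"
          by (simp flip: sum_subtractf)
        then show "\<bar>post_supply Q y $ j - post_supply Q' y' $ j\<bar>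
            \<le> \<bar>y $ j - y' $ j\<bar> + (\<Sum>i\<in>UNIV. \<bar>Q $ i $ j - Q' $ i $ j\<bar>)" by simp
      qed
      moreover have "(\<Sum>j\<in>UNIV. \<Sum>i\<in>UNIV. \<bar>Q $ i $ j - Q' $ i $ j\<bar>)
          = (\<Sum>i\<in>UNIV. \<Sum>j\<in>UNIV. \<bar>Q $ i $ j - Q' $ i $ j\<bar>)" by (rule sum.swap)
      ultimately have "(\<Sum>i\<in>UNIV. \<bar>post_demand Q x $ i - post_demand Q' x' $ i\<bar>)
          + (\<Sum>j\<in>UNIV. \<bar>post_supply Q y $ j - post_supply Q' y' $ j\<bar>) \<le> 3 * d"
        using Qd by (simp add: sum.distrib d_def)
      from mult_left_mono[OF this L]
      have "G (post_demand Q x) (post_supply Q y) \<le> G (post_demand Q' x') (post_supply Q' y') + L * (3 * d)"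
        using orthant_lipschitzD[OF G, of "post_demand Q x" "post_supply Q y" "post_demand Q' x'"
            "post_supply Q' y'"] Q Q' by (simp add: feasible_def del: post_demand_nth post_supply_nth)
      with 1 have "one_period c G Q x y \<le> one_period c G Q' x' y' + (C + 3 * L) * d"
        by (simp add: one_period_def algebra_simps)
      then show ?thesis using one_period_le_SUP[OF G Q', of c] by simp
    qed
    then show "(SUP Q\<in>feasible x y. one_period c G Q x y)
      \<le> (SUP Q\<in>feasible x' y'. one_period c G Q x' y') + (C + 3 * L) *
        ((\<Sum>i\<in>UNIV. \<bar>x $ i - x' $ i\<bar>) + (\<Sum>j\<in>UNIV. \<bar>y $ j - y' $ j\<bar>))"
      using zero_feasible[OF nn(1,2)] unfolding d_def by (intro cSUP_least) auto
  qed
  then show ?thesis by blast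
qed

section \<open>Expected future values\<close>

context dynamic_matching
begin

definition tail :: "nat \<Rightarrow> real ^ 'm \<Rightarrow> real ^ 'n \<Rightarrow> real" where
  "tail t u v = expectation (\<lambda>\<omega>. V (t + 1) (\<alpha> *\<^sub>R u + D (t + 1) \<omega>) (\<beta> *\<^sub>R v + S (t + 1) \<omega>))"

lemma H_eq: "H t Q x y = one_period (r t) (tail t) Q x y"
  by (simp add: H_def stage_value_def one_period_def tail_def weighted_total_def)

text \<open>
  The Lipschitz bound makes the integrands at two different states differ by a bounded amount. Hence
  they are both integrable or both not, and in the second case the claim reads \<open>0 \<le> 0 + K\<close>.
\<close>

lemma expectation_mono_gap:
  fixes W :: "real ^ 'm \<Rightarrow> real ^ 'n \<Rightarrow> real"
  defines "F \<equiv> \<lambda>t u v \<omega>. W (\<alpha> *\<^sub>R u + D t \<omega>) (\<beta> *\<^sub>R v + S t \<omega>)"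
  assumes W: "orthant_lipschitz L W" and t: "t \<in> {1..T}"
    and nn: "nonneg_vec u" "nonneg_vec v" "nonneg_vec u'" "nonneg_vec v'"
    and K: "0 \<le> K"
    and le: "\<And>\<omega>. \<omega> \<in> space M \<Longrightarrow> F t u v \<omega> \<le> F t u' v' \<omega> + K"
  shows "expectation (F t u v) \<le> expectation (F t u' v') + K"
proof -
  have states: "nonneg_vec (\<alpha> *\<^sub>R u + D t \<omega>)" "nonneg_vec (\<beta> *\<^sub>R v + S t \<omega>)"
    if "nonneg_vec u" "nonneg_vec v" "\<omega> \<in> space M" for u v \<omega>
    using that alpha_range beta_range D_nonneg[OF t] S_nonneg[OF t]
    by (auto intro: nonneg_vec_add_scaled)
  have meas: "F t u v \<in> borel_measurable M" if "nonneg_vec u" "nonneg_vec v" for u v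
  proof -
    let ?A = "{(x :: real ^ 'm, y :: real ^ 'n). nonneg_vec x \<and> nonneg_vec y}"
    have [measurable]: "D t \<in> borel_measurable M" "S t \<in> borel_measurable M"
      using D_measurable[OF t] S_measurable[OF t] by auto
    have "(\<lambda>\<omega>. (\<alpha> *\<^sub>R u + D t \<omega>, \<beta> *\<^sub>R v + S t \<omega>)) \<in> borel_measurable M"
      by measurable
    then have "(\<lambda>\<omega>. (\<alpha> *\<^sub>R u + D t \<omega>, \<beta> *\<^sub>R v + S t \<omega>)) \<in> measurable M (restrict_space borel ?A)"
      using states[OF that] by (intro measurable_restrict_space2) auto
    moreover have "(\<lambda>(x, y). W x y) \<in> borel_measurable (restrict_space borel ?A)"
      by (rule borel_measurable_continuous_on_restrict[OF orthant_lipschitz_imp_continuous_on[OF W]])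
    ultimately show ?thesis
      unfolding F_def by (auto dest: measurable_compose)
  qed
  have integrable_transfer: "integrable M (F t u' v')"
    if int: "integrable M (F t u v)"
      and nn: "nonneg_vec u" "nonneg_vec v" "nonneg_vec u'" "nonneg_vec v'" for u v u' v'
  proof -
    define d where "d = L * ((\<Sum>i\<in>UNIV. \<bar>(\<alpha> *\<^sub>R u) $ i - (\<alpha> *\<^sub>R u') $ i\<bar>)
      + (\<Sum>j\<in>UNIV. \<bar>(\<beta> *\<^sub>R v) $ j - (\<beta> *\<^sub>R v') $ j\<bar>))"
    have "norm (F t u' v' \<omega>) \<le> norm (\<bar>F t u v \<omega>\<bar> + \<bar>d\<bar>)" if \<omega>: "\<omega> \<in> space M" for \<omega>
    proof -
      have "F t u v \<omega> \<le> F t u' v' \<omega> + d"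
        using orthant_lipschitzD[OF W states[OF nn(1,2) \<omega>] states[OF nn(3,4) \<omega>]]
        by (simp add: F_def d_def)
      moreover have "F t u' v' \<omega> \<le> F t u v \<omega> + d"
        using orthant_lipschitzD[OF W states[OF nn(3,4) \<omega>] states[OF nn(1,2) \<omega>]]
        by (simp add: F_def d_def abs_minus_commute)
      ultimately show ?thesis by (simp add: abs_if split: if_splits)
    qed
    then have "AE \<omega> in M. norm (F t u' v' \<omega>) \<le> norm (\<bar>F t u v \<omega>\<bar> + \<bar>d\<bar>)" by simp
    moreover have "integrable M (\<lambda>\<omega>. \<bar>F t u v \<omega>\<bar> + \<bar>d\<bar>)" using int by simp
    ultimately show ?thesis using meas[OF nn(3,4)] by (blast intro: Bochner_Integration.integrable_bound)
  qed
  show ?thesis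
  proof (cases "integrable M (F t u v)")
    case True
    then have 2: "integrable M (F t u' v')" using integrable_transfer nn by blast
    have "expectation (F t u v) \<le> expectation (\<lambda>\<omega>. F t u' v' \<omega> + K)"
      using le True 2 by (intro integral_mono) auto
    then show ?thesis using 2 by (simp add: prob_space)
  next
    case False
    then have "\<not> integrable M (F t u' v')" using integrable_transfer nn by blast
    with False K show ?thesis by (simp add: not_integrable_integral_eq)
  qed
qed

lemma expected_lipschitz:
  assumes W: "orthant_lipschitz L W" and t: "t \<in> {1..T}"
  shows "orthant_lipschitz L
    (\<lambda>u v. expectation (\<lambda>\<omega>. W (\<alpha> *\<^sub>R u + D t \<omega>) (\<beta> *\<^sub>R v + S t \<omega>)))"
  unfolding orthant_lipschitz_def
proof (intro conjI allI impI)
  show L: "0 \<le> L" using W by (simp add: orthant_lipschitz_def)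
  fix u u' :: "real ^ 'm" and v v' :: "real ^ 'n"
  assume nn: "nonneg_vec u" "nonneg_vec v" "nonneg_vec u'" "nonneg_vec v'"
  let ?d = "(\<Sum>i\<in>UNIV. \<bar>u $ i - u' $ i\<bar>) + (\<Sum>j\<in>UNIV. \<bar>v $ j - v' $ j\<bar>)"
  have contract: "\<bar>a * p - a * q\<bar> \<le> \<bar>p - q\<bar>" if "a \<in> {0..1}" for a p q :: real
    using that mult_right_mono[of "\<bar>a\<bar>" 1 "\<bar>p - q\<bar>"] by (simp flip: right_diff_distrib add: abs_mult)
  have "(\<Sum>i\<in>UNIV. \<bar>\<alpha> * u $ i - \<alpha> * u' $ i\<bar>) + (\<Sum>j\<in>UNIV. \<bar>\<beta> * v $ j - \<beta> * v' $ j\<bar>) \<le> ?d"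
    using contract alpha_range beta_range by (intro add_mono sum_mono) auto
  note d = mult_left_mono[OF this L]
  show "expectation (\<lambda>\<omega>. W (\<alpha> *\<^sub>R u + D t \<omega>) (\<beta> *\<^sub>R v + S t \<omega>))
      \<le> expectation (\<lambda>\<omega>. W (\<alpha> *\<^sub>R u' + D t \<omega>) (\<beta> *\<^sub>R v' + S t \<omega>)) + L * ?d"
  proof (rule expectation_mono_gap[OF W t nn])
    show "0 \<le> L * ?d" using L by (intro mult_nonneg_nonneg add_nonneg_nonneg sum_nonneg) auto
    fix \<omega> assume \<omega>: "\<omega> \<in> space M"
    have "nonneg_vec (\<alpha> *\<^sub>R u + D t \<omega>)" "nonneg_vec (\<beta> *\<^sub>R v + S t \<omega>)"
      "nonneg_vec (\<alpha> *\<^sub>R u' + D t \<omega>)" "nonneg_vec (\<beta> *\<^sub>R v' + S t \<omega>)"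
      using nn alpha_range beta_range D_nonneg[OF t \<omega>] S_nonneg[OF t \<omega>]
      by (auto intro: nonneg_vec_add_scaled)
    from orthant_lipschitzD[OF W this] d
    show "W (\<alpha> *\<^sub>R u + D t \<omega>) (\<beta> *\<^sub>R v + S t \<omega>)
        \<le> W (\<alpha> *\<^sub>R u' + D t \<omega>) (\<beta> *\<^sub>R v' + S t \<omega>) + L * ?d" by simp
  qed
qed

lemma tail_last: "tail T u v = 0"
  by (simp add: tail_def V_def)

lemma V_eq_SUP: "t \<in> {1..T} \<Longrightarrow> V t x y = (SUP Q\<in>feasible x y. one_period (r t) (tail t) Q x y)"
  by (simp add: V_rec H_eq)

lemma tail_lipschitz:
  assumes "t \<in> {1..T}"
  shows "\<exists>L. orthant_lipschitz L (tail t)"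
proof -
  have "t \<le> T" using assms by simp
  then show ?thesis using assms
  proof (induction t rule: inc_induct)
    case base
    show ?case using orthant_lipschitz_const[of 0] by (auto simp: tail_last[abs_def])
  next
    case (step t)
    then have t: "t + 1 \<in> {1..T}" by auto
    then obtain L where "orthant_lipschitz L (tail (t + 1))" using step by auto
    from one_period_value_lipschitz[OF this, of "r (t + 1)"]
    obtain L' where "orthant_lipschitz L' (V (t + 1))"
      using V_eq_SUP[OF t, abs_def] by auto
    from expected_lipschitz[OF this t] show ?case by (auto simp: tail_def[abs_def])
  qed
qed

end

section \<open>Replacing a demand type by a dominated one\<close>

text \<open>
  The imitation argument for one period. Demand of type \<open>i\<close> is treated as a homogeneous mixture of
  the original \<open>x $ i\<close> and the extra \<open>\<eta>\<close> units, so the share \<open>s = \<eta> / (x $ i + \<eta>)\<close> of every match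
  of \<open>i\<close> is transferred to \<open>i'\<close>. If \<open>R\<close> is the total matched to \<open>i\<close>, then \<open>s * R\<close> of the extra units
  are used now, each losing at most \<open>m\<close> in reward, and \<open>\<eta> - s * R\<close> are left over, each losing
  at most \<open>m\<close> in \<open>G\<close>.
\<close>

lemma one_period_demand_swap:
  fixes c :: "'m::finite \<Rightarrow> 'n::finite \<Rightarrow> real"
  assumes G: "orthant_lipschitz L G" and ne: "i \<noteq> i'"
    and c: "\<And>l. c i l - c i' l \<le> m"
    and swap: "\<And>u v \<delta>. nonneg_vec u \<Longrightarrow> nonneg_vec v \<Longrightarrow> 0 \<le> \<delta> \<Longrightarrow>
      G (u + \<delta> *\<^sub>R axis i 1) v \<le> G (u + \<delta> *\<^sub>R axis i' 1) v + \<delta> * m"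
    and nn: "nonneg_vec x" "nonneg_vec y" and \<eta>: "0 \<le> \<eta>"
  shows "(SUP Q\<in>feasible (x + \<eta> *\<^sub>R axis i 1) y. one_period c G Q (x + \<eta> *\<^sub>R axis i 1) y)
    \<le> (SUP Q\<in>feasible (x + \<eta> *\<^sub>R axis i' 1) y. one_period c G Q (x + \<eta> *\<^sub>R axis i' 1) y) + \<eta> * m"
    (is "(SUP Q\<in>feasible ?z y. _ Q) \<le> (SUP Q\<in>feasible ?z' y. _ Q) + _")
proof (rule cSUP_least)
  have "nonneg_vec ?z" using nn \<eta> by (simp add: nonneg_vec_def axis_def)
  then show "feasible ?z y \<noteq> {}" using zero_feasible nn by blast
next
  fix Q :: "('m, 'n) decision" assume Q: "Q \<in> feasible ?z y"
  define R where "R = (\<Sum>l\<in>UNIV. Q $ i $ l)"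
  define s where "s = \<eta> / (x $ i + \<eta>)"
  define Q' :: "('m, 'n) decision" where
    "Q' = (\<chi> k l. Q $ k $ l + (if k = i' then s * Q $ i $ l else 0) - (if k = i then s * Q $ i $ l else 0))"
  have xi: "0 \<le> x $ i" using nn by (simp add: nonneg_vec_def)
  have Qnn: "0 \<le> Q $ k $ l" for k l using Q by (simp add: mem_feasible_iff)
  have rows: "(\<Sum>l\<in>UNIV. Q $ k $ l) \<le> x $ k + (if k = i then \<eta> else 0)" for k
    using Q by (auto simp: mem_feasible_iff axis_def dest: spec[of _ k])
  have R: "0 \<le> R" "R \<le> x $ i + \<eta>" using rows[of i] Qnn by (auto simp: R_def intro: sum_nonneg)
  \<comment> \<open>if \<open>x $ i + \<eta> = 0\<close>, then \<open>s = 0\<close> by division by zero, and the equation still holds as \<open>\<eta> = 0\<close>\<close>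
  have s: "0 \<le> s" "s \<le> 1" "s * (x $ i + \<eta>) = \<eta>"
    using xi \<eta> by (auto simp: s_def divide_le_eq_1 add_nonneg_eq_0_iff)
  have sR: "s * R \<le> \<eta>" using mult_left_mono[OF R(2) s(1)] s(3) by simp
  have rest: "R - s * R \<le> x $ i"
    using mult_left_mono[OF R(2), of "1 - s"] s by (simp add: algebra_simps)
  have row': "(\<Sum>l\<in>UNIV. Q' $ k $ l)
      = (\<Sum>l\<in>UNIV. Q $ k $ l) + (if k = i' then s * R else 0) - (if k = i then s * R else 0)" for k
    using ne by (simp add: Q'_def R_def sum.distrib sum_subtractf sum_distrib_left)
  have col': "(\<Sum>k\<in>UNIV. Q' $ k $ l) = (\<Sum>k\<in>UNIV. Q $ k $ l)" for l
    by (simp add: Q'_def sum.distrib sum_subtractf)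
  define p where "p = post_demand Q ?z - (\<eta> - s * R) *\<^sub>R axis i 1"
  have z: "post_demand Q ?z = p + (\<eta> - s * R) *\<^sub>R axis i 1" by (simp add: p_def)
  have z': "post_demand Q' ?z' = p + (\<eta> - s * R) *\<^sub>R axis i' 1"
    using ne by (simp add: vec_eq_iff p_def row' axis_def)
  have supply': "post_supply Q' y = post_supply Q y" by (simp add: vec_eq_iff col')
  have "0 \<le> p $ k" for k
    using rows[of k] rest by (cases "k = i") (auto simp: p_def axis_def R_def)
  then have p: "nonneg_vec p" by (simp add: nonneg_vec_def)
  have Q': "Q' \<in> feasible ?z' y"
    unfolding feasible_def mem_Collect_eq
  proof (intro conjI allI)
    show "0 \<le> Q' $ k $ l" for k l
      using s Qnn mult_right_mono[OF s(2) Qnn[of i l]] by (auto simp: Q'_def ne)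
    show "nonneg_vec (post_demand Q' ?z')"
      unfolding z' using p sR by (auto simp: nonneg_vec_def axis_def)
    show "nonneg_vec (post_supply Q' y)" unfolding supply' using Q by (simp add: feasible_def)
  qed
  have "weighted_total c Q' = (\<Sum>k\<in>UNIV. (\<Sum>l\<in>UNIV. c k l * Q $ k $ l)
      + (if k = i' then (\<Sum>l\<in>UNIV. c k l * (s * Q $ i $ l)) else 0)
      - (if k = i then (\<Sum>l\<in>UNIV. c k l * (s * Q $ i $ l)) else 0))"
    unfolding weighted_total_def Q'_def
    by (intro sum.cong refl) (simp add: algebra_simps sum.distrib sum_subtractf)
  also have "\<dots> = weighted_total c Q + (\<Sum>l\<in>UNIV. c i' l * (s * Q $ i $ l))
      - (\<Sum>l\<in>UNIV. c i l * (s * Q $ i $ l))"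
    by (simp add: weighted_total_def sum.distrib sum_subtractf)
  finally have "weighted_total c Q - weighted_total c Q'
      = (\<Sum>l\<in>UNIV. (c i l - c i' l) * (s * Q $ i $ l))"
    by (simp add: left_diff_distrib sum_subtractf)
  also have "\<dots> \<le> (\<Sum>l\<in>UNIV. m * (s * Q $ i $ l))"
    using c s Qnn by (intro sum_mono mult_right_mono) auto
  also have "\<dots> = s * R * m" by (simp add: R_def sum_distrib_left mult_ac)
  finally have "weighted_total c Q \<le> weighted_total c Q' + s * R * m" by simp
  moreover have "G (post_demand Q ?z) (post_supply Q y)
      \<le> G (post_demand Q' ?z') (post_supply Q' y) + (\<eta> - s * R) * m"
    unfolding z z' supply' using Q sR by (intro swap p) (auto simp: feasible_def)
  ultimately have "one_period c G Q ?z y \<le> one_period c G Q' ?z' y + \<eta> * m"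
    by (simp add: one_period_def algebra_simps)
  then show "one_period c G Q ?z y \<le> (SUP Q\<in>feasible ?z' y. one_period c G Q ?z' y) + \<eta> * m"
    using one_period_le_SUP[OF G Q', of c] by simp
qed

context dynamic_matching
begin

lemma V_lipschitz:
  assumes "t \<in> {1..T}"
  shows "\<exists>L. orthant_lipschitz L (V t)"
proof -
  obtain L where "orthant_lipschitz L (tail t)" using tail_lipschitz[OF assms] by blast
  from one_period_value_lipschitz[OF this, of "r t"] show ?thesis
    using V_eq_SUP[OF assms, abs_def] by simp
qed

lemma weakly_dominates_demandD:
  assumes "weakly_dominates (i, j) (i', j)" "t \<in> {1..T}"
  shows "i \<noteq> i'" "r t i' j \<le> r t i j"
    "\<alpha> * (r (t + 1) i l - r (t + 1) i' l) \<le> r t i j - r t i' j"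
  using assms by (auto simp: weakly_dominates_def)

text \<open>
  Backward induction on the period; let \<open>\<alpha> > 0\<close>. After one period of carry-over, \<open>\<delta>\<close> units have become
  \<open>\<alpha> * \<delta>\<close>, and each may cost \<open>m = (r t i j - r t i' j) / \<alpha>\<close>: the dominance relation bounds by \<open>m\<close> the
  loss of reward in period \<open>t + 1\<close> at every supply type. Its instance at \<open>j\<close> itself bounds
  the loss per unit carried over further, which the induction hypothesis supplies.
\<close>

lemma tail_demand_swap:
  assumes dom: "weakly_dominates (i, j) (i', j)" and t: "t \<in> {1..T}"
    and "nonneg_vec u" "nonneg_vec v" "0 \<le> \<delta>"
  shows "tail t (u + \<delta> *\<^sub>R axis i 1) v \<le> tail t (u + \<delta> *\<^sub>R axis i' 1) v + \<delta> * (r t i j - r t i' j)"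
proof -
  have "t \<le> T" using t by simp
  then show ?thesis using t assms(3-)
  proof (induction t arbitrary: u v \<delta> rule: inc_induct)
    case base
    then show ?case using weakly_dominates_demandD(2)[OF dom] by (simp add: tail_last)
  next
    case (step t)
    note D = weakly_dominates_demandD[OF dom \<open>t \<in> {1..T}\<close>]
    have t1: "t + 1 \<in> {1..T}" using step.hyps by auto
    show ?case
    proof (cases "\<alpha> = 0")
      case True
      then have "tail t (u + \<delta> *\<^sub>R axis i 1) v = tail t (u + \<delta> *\<^sub>R axis i' 1) v"
        unfolding tail_def using True by simp
      then show ?thesis using D(2) step.prems by simp
    next
      case False
      then have \<alpha>: "0 < \<alpha>" using alpha_range by auto
      define m where "m = (r t i j - r t i' j) / \<alpha>"
      have m: "r (t + 1) i l - r (t + 1) i' l \<le> m" for l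
        using D(3)[of l] \<alpha> by (simp add: m_def field_simps)
      obtain L where L: "orthant_lipschitz L (V (t + 1))" using V_lipschitz[OF t1] by blast
      obtain L' where L': "orthant_lipschitz L' (tail (t + 1))" using tail_lipschitz[OF t1] by blast
      have swap: "tail (t + 1) (u + \<delta> *\<^sub>R axis i 1) v \<le> tail (t + 1) (u + \<delta> *\<^sub>R axis i' 1) v + \<delta> * m"
        if "nonneg_vec u" "nonneg_vec v" "0 \<le> \<delta>" for u v \<delta>
        using step.IH[OF _ that] t1 mult_left_mono[OF m[of j] that(3)] by simp
      show ?thesis
        unfolding tail_def
      proof (rule expectation_mono_gap[OF L t1])
        show "nonneg_vec (u + \<delta> *\<^sub>R axis i 1)" "nonneg_vec v"
          "nonneg_vec (u + \<delta> *\<^sub>R axis i' 1)" "nonneg_vec v"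
          using step.prems by (auto simp: nonneg_vec_def axis_def)
        show "0 \<le> \<delta> * (r t i j - r t i' j)" using D(2) step.prems by simp
        fix \<omega> assume \<omega>: "\<omega> \<in> space M"
        have "nonneg_vec (\<alpha> *\<^sub>R u + D (t + 1) \<omega>)" "nonneg_vec (\<beta> *\<^sub>R v + S (t + 1) \<omega>)"
          using step.prems alpha_range beta_range D_nonneg[OF t1 \<omega>] S_nonneg[OF t1 \<omega>]
          by (auto intro: nonneg_vec_add_scaled)
        moreover have "0 \<le> \<alpha> * \<delta>" using \<alpha> step.prems by simp
        ultimately have "V (t + 1) (\<alpha> *\<^sub>R u + D (t + 1) \<omega> + (\<alpha> * \<delta>) *\<^sub>R axis i 1) (\<beta> *\<^sub>R v + S (t + 1) \<omega>)
          \<le> V (t + 1) (\<alpha> *\<^sub>R u + D (t + 1) \<omega> + (\<alpha> * \<delta>) *\<^sub>R axis i' 1) (\<beta> *\<^sub>R v + S (t + 1) \<omega>)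
            + \<alpha> * \<delta> * m"
          unfolding V_eq_SUP[OF t1] by (intro one_period_demand_swap[OF L' D(1) m swap])
        then show "V (t + 1) (\<alpha> *\<^sub>R (u + \<delta> *\<^sub>R axis i 1) + D (t + 1) \<omega>) (\<beta> *\<^sub>R v + S (t + 1) \<omega>)
          \<le> V (t + 1) (\<alpha> *\<^sub>R (u + \<delta> *\<^sub>R axis i' 1) + D (t + 1) \<omega>) (\<beta> *\<^sub>R v + S (t + 1) \<omega>)
            + \<delta> * (r t i j - r t i' j)"
          using \<alpha> by (simp add: m_def scaleR_add_right add_ac)
      qed
    qed
  qed
qed

end

section \<open>Exchange steps\<close>

lemma weighted_total_add_unit:
  "weighted_total w (Q + e *\<^sub>R axis i (axis j 1)) = weighted_total w Q + e * w i j"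
proof -
  have "w k l * (Q + e *\<^sub>R axis i (axis j 1)) $ k $ l
      = w k l * Q $ k $ l + (if k = i then if l = j then e * w i j else 0 else 0)" for k l
    by (simp add: axis_def algebra_simps)
  then have "weighted_total w (Q + e *\<^sub>R axis i (axis j 1))
      = (\<Sum>k\<in>UNIV. \<Sum>l\<in>UNIV. w k l * Q $ k $ l + (if k = i then if l = j then e * w i j else 0 else 0))"
    unfolding weighted_total_def by presburger
  also have "\<dots> = (\<Sum>k\<in>UNIV. (\<Sum>l\<in>UNIV. w k l * Q $ k $ l) + (if k = i then e * w i j else 0))"
    by (intro sum.cong refl) (simp add: sum.distrib)
  also have "\<dots> = weighted_total w Q + e * w i j"
    by (simp add: sum.distrib weighted_total_def)
  finally show ?thesis .
qed

lemma post_demand_add_unit: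
  "post_demand (Q + e *\<^sub>R axis i (axis j 1)) x = post_demand Q x - e *\<^sub>R axis i 1"
  by (simp add: vec_eq_iff axis_def sum.distrib if_distrib[of "\<lambda>v. v $ _"]
      if_distrib[of "(*) _"] cong: if_cong)

lemma post_supply_add_unit:
  "post_supply (Q + e *\<^sub>R axis i (axis j 1)) y = post_supply Q y - e *\<^sub>R axis j 1"
  by (simp add: vec_eq_iff axis_def sum.distrib if_distrib[of "\<lambda>v. v $ _"]
      if_distrib[of "(*) _"] cong: if_cong)

context dynamic_matching
begin

text \<open>
  Doubling makes the weight of a pair at least the sum of the weights of any two pairs that it
  dominates, which is what the four-pair exchange takes away; positivity makes its net effect strict.
\<close>

definition doubling_weight :: "('m \<Rightarrow> 'n \<Rightarrow> real) \<Rightarrow> bool" where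
  "doubling_weight w \<longleftrightarrow> (\<forall>i j. 0 < w i j) \<and>
    (\<forall>i j i' j'. (i, j) \<succ> (i', j') \<longrightarrow> 2 * w i' j' \<le> w i j)"

text \<open>
  The level \<open>a_level i j\<close> is the remainder of \<open>i\<close> plus what \<open>i\<close> matches to supply types \<open>j'\<close> with
  \<open>(i, j) \<succ> (i, j')\<close>. If it is not zero, one of these two sources can be used to move supply \<open>j\<close> from
  \<open>i'\<close> to \<open>i\<close>.
\<close>

lemma exchange_improves_weight:
  assumes Monge: modified_Monge and w: "doubling_weight w" and t: "t \<in> {1..T}"
    and Q: "Q \<in> feasible x y" and dom: "(i, j) \<succ> (i', j)"
    and pos: "Q $ i' $ j \<noteq> 0" and level: "a_level i j Q x \<noteq> 0"
  shows "\<exists>Q'\<in>feasible x y. H t Q x y \<le> H t Q' x y \<and> weighted_total w Q < weighted_total w Q'"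
proof -
  have wdom: "weakly_dominates (i, j) (i', j)" using dom by (simp add: dominates_def)
  have ne: "i \<noteq> i'" using weakly_dominates_demandD(1)[OF wdom t] .
  have Qnn: "0 \<le> Q $ k $ l" for k l using Q by (simp add: mem_feasible_iff)
  have wpos: "0 < w k l" for k l using w by (simp add: doubling_weight_def)
  have pos: "0 < Q $ i' $ j" using pos Qnn[of i' j] by simp
  have u: "0 \<le> post_demand Q x $ i" for i
    using Q by (simp add: feasible_def nonneg_vec_def)
  have v: "nonneg_vec (post_supply Q y)" using Q by (simp add: feasible_def)
  have "(\<Sum>l\<in>UNIV. Q $ i $ l)
      = (\<Sum>l\<in>{l. (i, l) \<notin> B_L i j}. Q $ i $ l) + (\<Sum>l\<in>{l. (i, l) \<in> B_L i j}. Q $ i $ l)"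
    by (subst sum.union_disjoint[symmetric]) (auto intro: sum.cong)
  then have "a_level i j Q x = post_demand Q x $ i + (\<Sum>l\<in>{l. (i, l) \<in> B_L i j}. Q $ i $ l)"
    by (simp add: a_level_def)
  with level consider (slack) "post_demand Q x $ i \<noteq> 0"
    | (sum) "(\<Sum>l\<in>{l. (i, l) \<in> B_L i j}. Q $ i $ l) \<noteq> 0" by fastforce
  then show ?thesis
  proof cases
    case slack
    define e where "e = min (post_demand Q x $ i) (Q $ i' $ j)"
    have e: "0 < e" "e \<le> post_demand Q x $ i" "e \<le> Q $ i' $ j"
      using slack u[of i] pos by (auto simp: e_def simp del: post_demand_nth)
    define Q' where "Q' = Q + e *\<^sub>R axis i (axis j 1) + (- e) *\<^sub>R axis i' (axis j 1)"
    define p where "p = post_demand Q x - e *\<^sub>R axis i 1"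
    have p: "nonneg_vec p"
      using e u by (auto simp: nonneg_vec_def p_def axis_def simp del: post_demand_nth)
    have d: "post_demand Q x = p + e *\<^sub>R axis i 1" by (simp add: p_def)
    have d': "post_demand Q' x = p + e *\<^sub>R axis i' 1"
      unfolding Q'_def post_demand_add_unit by (simp add: p_def)
    have s': "post_supply Q' y = post_supply Q y"
      unfolding Q'_def post_supply_add_unit by simp
    have total: "weighted_total c Q' = weighted_total c Q + e * c i j - e * c i' j" for c
      unfolding Q'_def weighted_total_add_unit by simp
    have "Q' \<in> feasible x y"
      unfolding feasible_def mem_Collect_eq
    proof (intro conjI allI)
      show "0 \<le> Q' $ k $ l" for k l
        using e ne Qnn[of k l] by (auto simp: Q'_def axis_def)
      show "nonneg_vec (post_demand Q' x)"
        unfolding d' using p e by (auto simp: nonneg_vec_def axis_def)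
      show "nonneg_vec (post_supply Q' y)" unfolding s' by (rule v)
    qed
    moreover have "H t Q x y \<le> H t Q' x y"
      using tail_demand_swap[OF wdom t p v, of e] e
      unfolding H_eq one_period_def total d d' s' by (simp add: algebra_simps)
    moreover have "w i' j < w i j"
      using w dom wpos[of i' j] unfolding doubling_weight_def by fastforce
    with e have "weighted_total w Q < weighted_total w Q'" by (simp add: total)
    ultimately show ?thesis by blast
  next
    case sum
    then obtain j' where "(i, j') \<in> B_L i j" "Q $ i $ j' \<noteq> 0"
      by (auto elim: sum.not_neutral_contains_not_neutral)
    then have j': "j' \<noteq> j" "(i, j) \<succ> (i, j')" and pos': "0 < Q $ i $ j'"
      using Qnn[of i j'] by (auto simp: B_L_def)
    define e where "e = min (Q $ i $ j') (Q $ i' $ j)"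
    have e: "0 < e" "e \<le> Q $ i $ j'" "e \<le> Q $ i' $ j" using pos pos' by (auto simp: e_def)
    define Q' where "Q' = Q + e *\<^sub>R axis i (axis j 1) + e *\<^sub>R axis i' (axis j' 1)
      + (- e) *\<^sub>R axis i (axis j' 1) + (- e) *\<^sub>R axis i' (axis j 1)"
    have d': "post_demand Q' x = post_demand Q x"
      unfolding Q'_def post_demand_add_unit by simp
    have s': "post_supply Q' y = post_supply Q y"
      unfolding Q'_def post_supply_add_unit by simp
    have total: "weighted_total c Q' = weighted_total c Q + e * (c i j + c i' j' - c i j' - c i' j)" for c
      unfolding Q'_def weighted_total_add_unit by (simp add: algebra_simps)
    have "Q' \<in> feasible x y"
      unfolding feasible_def mem_Collect_eq d' s'
      using Q e ne j' Qnn by (auto simp: feasible_def Q'_def axis_def)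
    moreover have "r t i j' + r t i' j \<le> r t i j + r t i' j'"
      using Monge t dom j' unfolding modified_Monge_def by blast
    with e have "H t Q x y \<le> H t Q' x y"
      unfolding H_eq one_period_def total d' s' by simp
    moreover have "2 * w i' j \<le> w i j" "2 * w i j' \<le> w i j"
      using w dom j' unfolding doubling_weight_def by blast+
    with wpos[of i' j'] have "0 < w i j + w i' j' - w i j' - w i' j" by linarith
    with e have "weighted_total w Q < weighted_total w Q'" by (simp add: total)
    ultimately show ?thesis by blast
  qed
qed

text \<open>
  A numerical form of acyclicity. If no reward decreases strictly from \<open>(i, j)\<close> to \<open>(i', j)\<close>, then
  dominance says only that the carry-over rewards of \<open>i\<close> are at most those of \<open>i'\<close>. Were all of
  these equal too, the two pairs would dominate each other, which the strict relation
  excludes. The second quantity depends on the demand type alone, so it does not change in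
  a step between two supply types.
\<close>

lemma demand_dominates_lexicographic:
  assumes "(i, j) \<succ> (i', j)"
  shows "(\<Sum>t\<in>{1..T}. r t i' j) < (\<Sum>t\<in>{1..T}. r t i j) \<or>
    (\<Sum>t\<in>{1..T}. r t i' j) = (\<Sum>t\<in>{1..T}. r t i j) \<and>
    (\<Sum>t\<in>{1..T}. \<Sum>l\<in>UNIV. \<alpha> * r (t + 1) i l) < (\<Sum>t\<in>{1..T}. \<Sum>l\<in>UNIV. \<alpha> * r (t + 1) i' l)"
proof (cases "\<exists>t\<in>{1..T}. r t i' j < r t i j")
  case True
  have "weakly_dominates (i, j) (i', j)" using assms by (simp add: dominates_def)
  then show ?thesis using True
    by (intro disjI1 sum_strict_mono_ex1) (auto simp: weakly_dominates_def)
next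
  case False
  have dom: "weakly_dominates (i, j) (i', j)" and ndom: "\<not> weakly_dominates (i', j) (i, j)"
    using assms by (auto simp: dominates_def)
  have eq: "r t i' j = r t i j" if "t \<in> {1..T}" for t
    using False weakly_dominates_demandD(2)[OF dom that] that by force
  have le: "\<alpha> * r (t + 1) i l \<le> \<alpha> * r (t + 1) i' l" if "t \<in> {1..T}" for t l
    using weakly_dominates_demandD(3)[OF dom that, of l] eq[OF that] by (simp add: algebra_simps)
  have "i \<noteq> i'" using dom T_ge_1 by (auto simp: weakly_dominates_def)
  then obtain t l where t: "t \<in> {1..T}" and l: "\<alpha> * r (t + 1) i l < \<alpha> * r (t + 1) i' l"
    using ndom eq by (auto simp: weakly_dominates_def algebra_simps not_le)
  have "(\<Sum>t\<in>{1..T}. \<Sum>l\<in>UNIV. \<alpha> * r (t + 1) i l) < (\<Sum>t\<in>{1..T}. \<Sum>l\<in>UNIV. \<alpha> * r (t + 1) i' l)"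
  proof (rule sum_strict_mono_ex1)
    show "\<forall>t\<in>{1..T}. (\<Sum>l\<in>UNIV. \<alpha> * r (t + 1) i l) \<le> (\<Sum>l\<in>UNIV. \<alpha> * r (t + 1) i' l)"
      using le by (auto intro: sum_mono)
    show "\<exists>t\<in>{1..T}. (\<Sum>l\<in>UNIV. \<alpha> * r (t + 1) i l) < (\<Sum>l\<in>UNIV. \<alpha> * r (t + 1) i' l)"
      using t l le[OF t] by (intro bexI[of _ t] sum_strict_mono_ex1) auto
  qed simp
  moreover have "(\<Sum>t\<in>{1..T}. r t i' j) = (\<Sum>t\<in>{1..T}. r t i j)" using eq by (intro sum.cong) auto
  ultimately show ?thesis by blast
qed

end

section \<open>Symmetry between demand and supply\<close>

lemma post_demand_transpose: "post_demand (transpose Q) y = post_supply Q y"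
  by (simp add: vec_eq_iff transpose_def)

lemma post_supply_transpose: "post_supply (transpose Q) x = post_demand Q x"
  by (simp add: vec_eq_iff transpose_def)

lemma transpose_feasible: "transpose Q \<in> feasible y x \<longleftrightarrow> Q \<in> feasible x y"
  by (auto simp: feasible_def post_demand_transpose post_supply_transpose) (auto simp: transpose_def)

lemma feasible_transpose_image: "feasible y x = transpose ` feasible x y"
proof -
  have "Q \<in> transpose ` feasible x y" if "Q \<in> feasible y x" for Q
    using that transpose_feasible[of Q x y] by (intro image_eqI[of _ _ "transpose Q"]) auto
  then show ?thesis by (auto simp: transpose_feasible)
qed

lemma weighted_total_transpose:
  "weighted_total (\<lambda>j i. w i j) (transpose Q) = weighted_total w Q"
  unfolding weighted_total_def by (subst sum.swap) (simp add: transpose_def)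

context dynamic_matching
begin

interpretation mirror: dynamic_matching M T \<beta> \<alpha> "\<lambda>t j i. r t i j" S D
  by unfold_locales (use T_ge_1 alpha_range beta_range r_terminal D_measurable S_measurable
      D_nonneg S_nonneg in auto)

lemma mirror_dominates: "mirror.dominates (j, i) (j', i') \<longleftrightarrow> (i, j) \<succ> (i', j')"
  by (auto simp: mirror.dominates_def dominates_def mirror.weakly_dominates_def weakly_dominates_def)

lemma mirror_modified_Monge: "mirror.modified_Monge \<longleftrightarrow> modified_Monge"
  unfolding mirror.modified_Monge_def modified_Monge_def mirror_dominates
  by (metis add.commute)

lemma mirror_doubling_weight: "mirror.doubling_weight (\<lambda>j i. w i j) \<longleftrightarrow> doubling_weight w"
  unfolding mirror.doubling_weight_def doubling_weight_def mirror_dominates by blast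

lemma mirror_a_level: "mirror.a_level j i (transpose Q) y = b_level i j Q y"
proof -
  have "(j, k) \<in> mirror.B_L j i \<longleftrightarrow> (k, j) \<in> B_R i j" for k
    by (simp add: mirror.B_L_def B_R_def mirror_dominates)
  then show ?thesis by (simp add: mirror.a_level_def b_level_def transpose_def)
qed

lemma mirror_stage_value:
  assumes "\<And>x y. W' y x = W x y"
  shows "mirror.stage_value W' t (transpose Q) y x = stage_value W t Q x y"
  using weighted_total_transpose[of "r t" Q]
  by (simp add: mirror.stage_value_def stage_value_def assms post_demand_transpose
      post_supply_transpose weighted_total_def)

lemma mirror_V_to_go: "mirror.V_to_go k y x = V_to_go k x y"
proof (induction k arbitrary: x y)
  case (Suc k)
  have "mirror.V_to_go (Suc k) y x
      = (SUP Q\<in>feasible x y. mirror.stage_value (mirror.V_to_go k) (T - k) (transpose Q) y x)"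
    by (simp add: feasible_transpose_image[of y x] image_image)
  also have "\<dots> = V_to_go (Suc k) x y" by (simp add: mirror_stage_value[OF Suc.IH])
  finally show ?case .
qed simp

lemma mirror_H: "mirror.H t (transpose Q) y x = H t Q x y"
  unfolding mirror.H_def H_def mirror.V_def V_def by (rule mirror_stage_value[OF mirror_V_to_go])

lemma exchange_improves_weight_supply:
  assumes "modified_Monge" "doubling_weight w" "t \<in> {1..T}"
    and Q: "Q \<in> feasible x y" and dom: "(i, j) \<succ> (i, j')"
    and "Q $ i $ j' \<noteq> 0" and "b_level i j Q y \<noteq> 0"
  shows "\<exists>Q'\<in>feasible x y. H t Q x y \<le> H t Q' x y \<and> weighted_total w Q < weighted_total w Q'"
proof -
  have "\<exists>Q'\<in>feasible y x. mirror.H t (transpose Q) y x \<le> mirror.H t Q' y x \<and>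
      weighted_total (\<lambda>j i. w i j) (transpose Q) < weighted_total (\<lambda>j i. w i j) Q'"
    using assms
    by (intro mirror.exchange_improves_weight[of _ _ _ _ _ j i j'])
      (simp_all add: mirror_modified_Monge mirror_doubling_weight transpose_feasible
        mirror_dominates mirror_a_level, simp_all add: transpose_def)
  then show ?thesis
    by (auto simp: feasible_transpose_image[of y x] mirror_H weighted_total_transpose)
qed

text \<open>
  Every step of \<open>\<succ>\<close> leads to a lexicographically smaller pair of total reward \<open>f\<close> and negated total
  carry-over reward \<open>- g\<close>, where \<open>g\<close> is the sum of a demand part and a supply part, of which a step
  changes only one. The weight is a power of two with the rank in this order as exponent.
\<close>

lemma exists_doubling_weight: "\<exists>w. doubling_weight w"
proof -
  define f where "f = (\<lambda>(i, j). \<Sum>t\<in>{1..T}. r t i j)"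
  define g where "g = (\<lambda>(i, j). (\<Sum>t\<in>{1..T}. \<Sum>l\<in>UNIV. \<alpha> * r (t + 1) i l)
    + (\<Sum>t\<in>{1..T}. \<Sum>k\<in>UNIV. \<beta> * r (t + 1) k j))"
  define below where "below = (\<lambda>p. {p'. f p' < f p \<or> f p' = f p \<and> g p < g p'})"
  have key: "p' \<in> below p" if dom: "p \<succ> p'" for p p'
  proof -
    obtain i j i' j' where p: "p = (i, j)" "p' = (i', j')" by (metis surj_pair)
    consider "j' = j" | "i' = i"
      using dom by (auto simp: p dominates_def weakly_dominates_def)
    then show ?thesis
    proof cases
      case 1
      then show ?thesis using demand_dominates_lexicographic[of i j i'] dom
        by (auto simp: p below_def f_def g_def)
    next
      case 2
      then show ?thesis using mirror.demand_dominates_lexicographic[of j i j'] dom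
        by (auto simp: p below_def f_def g_def mirror_dominates)
    qed
  qed
  have rank: "card (below p') < card (below p)" if "p \<succ> p'" for p p'
  proof (rule psubset_card_mono)
    show "below p' \<subset> below p" using key[OF that] by (auto simp: below_def)
  qed simp
  define w :: "'m \<Rightarrow> 'n \<Rightarrow> real" where "w = (\<lambda>i j. 2 ^ card (below (i, j)))"
  have "2 * w i' j' \<le> w i j" if "(i, j) \<succ> (i', j')" for i j i' j'
    using power_increasing[of "Suc (card (below (i', j')))" "card (below (i, j))" "2 :: real"]
      rank[OF that] by (simp add: w_def)
  then have "doubling_weight w" by (simp add: doubling_weight_def w_def)
  then show ?thesis by blast
qed

lemma optimal_respecting_decision:
  assumes Monge: modified_Monge and t: "t \<in> {1..T}" and nn: "nonneg_vec x" "nonneg_vec y"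
  shows "\<exists>Q. Q \<in> feasible x y \<and> (\<forall>Q'\<in>feasible x y. H t Q' x y \<le> H t Q x y) \<and>
    (\<forall>i i' j. (i, j) \<succ> (i', j) \<longrightarrow> Q $ i' $ j = 0 \<or> a_level i j Q x = 0) \<and>
    (\<forall>i j j'. (i, j) \<succ> (i, j') \<longrightarrow> Q $ i $ j' = 0 \<or> b_level i j Q y = 0)"
proof -
  obtain w where w: "doubling_weight w" using exists_doubling_weight by blast
  obtain L where L: "orthant_lipschitz L (tail t)" using tail_lipschitz[OF t] by blast
  obtain Q0 where Q0: "Q0 \<in> feasible x y"
    and max: "\<And>Q. Q \<in> feasible x y \<Longrightarrow> H t Q x y \<le> H t Q0 x y"
    using one_period_attains_max[OF L nn] unfolding H_eq by metis
  define Opt where "Opt = {Q \<in> feasible x y. H t Q x y = H t Q0 x y}"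
  have "continuous_on (feasible x y) (\<lambda>Q. H t Q x y)"
    unfolding H_eq by (rule continuous_on_one_period[OF L])
  then have "closed Opt"
    unfolding Opt_def by (intro continuous_closed_preimage_constant compact_imp_closed compact_feasible)
  then have "compact Opt"
    using compact_Int_closed[OF compact_feasible[of x y], of Opt]
    by (simp add: Opt_def Int_absorb1 Collect_restrict)
  moreover have "Opt \<noteq> {}" using Q0 by (auto simp: Opt_def)
  ultimately obtain Q where Q: "Q \<in> Opt" and Qmax: "\<And>Q'. Q' \<in> Opt \<Longrightarrow> weighted_total w Q' \<le> weighted_total w Q"
    using continuous_attains_sup[OF _ _ continuous_on_weighted_total] by metis
  have feas: "Q \<in> feasible x y" and HQ: "H t Q x y = H t Q0 x y" using Q by (auto simp: Opt_def)
  have no_gain: False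
    if gain: "\<exists>Q'\<in>feasible x y. H t Q x y \<le> H t Q' x y \<and> weighted_total w Q < weighted_total w Q'"
  proof -
    obtain Q' where Q': "Q' \<in> feasible x y" "H t Q x y \<le> H t Q' x y"
      "weighted_total w Q < weighted_total w Q'" using gain by blast
    then have "Q' \<in> Opt" using max[OF Q'(1)] HQ by (simp add: Opt_def)
    with Qmax Q'(3) show False by fastforce
  qed
  show ?thesis
  proof (intro exI[of _ Q] conjI ballI allI impI)
    show "Q \<in> feasible x y" by (rule feas)
    show "H t Q' x y \<le> H t Q x y" if "Q' \<in> feasible x y" for Q'
      using max[OF that] HQ by simp
    show "Q $ i' $ j = 0 \<or> a_level i j Q x = 0" if "(i, j) \<succ> (i', j)" for i i' j
      using no_gain exchange_improves_weight[OF Monge w t feas that] by blast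
    show "Q $ i $ j' = 0 \<or> b_level i j Q y = 0" if "(i, j) \<succ> (i, j')" for i j j'
      using no_gain exchange_improves_weight_supply[OF Monge w t feas that] by blast
  qed
qed

lemma optimal_respecting_policy:
  assumes Monge: modified_Monge
  shows "\<exists>q. optimal_policy q \<and> respects_dominance q"
proof -
  have "\<exists>Q. t \<in> {1..T} \<longrightarrow> nonneg_vec x \<longrightarrow> nonneg_vec y \<longrightarrow>
    Q \<in> feasible x y \<and> (\<forall>Q'\<in>feasible x y. H t Q' x y \<le> H t Q x y) \<and>
    (\<forall>i i' j. (i, j) \<succ> (i', j) \<longrightarrow> Q $ i' $ j = 0 \<or> a_level i j Q x = 0) \<and>
    (\<forall>i j j'. (i, j) \<succ> (i, j') \<longrightarrow> Q $ i $ j' = 0 \<or> b_level i j Q y = 0)" for t x y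
    using optimal_respecting_decision[OF Monge] by blast
  then obtain q where "\<forall>t x y. t \<in> {1..T} \<longrightarrow> nonneg_vec x \<longrightarrow> nonneg_vec y \<longrightarrow>
    q t x y \<in> feasible x y \<and> (\<forall>Q'\<in>feasible x y. H t Q' x y \<le> H t (q t x y) x y) \<and>
    (\<forall>i i' j. (i, j) \<succ> (i', j) \<longrightarrow> q t x y $ i' $ j = 0 \<or> a_level i j (q t x y) x = 0) \<and>
    (\<forall>i j j'. (i, j) \<succ> (i, j') \<longrightarrow> q t x y $ i $ j' = 0 \<or> b_level i j (q t x y) y = 0)"
    by metis
  then show ?thesis
    unfolding optimal_policy_def matching_policy_def respects_dominance_def
    by (intro exI[of _ q]) blast
qed

end

theorem theorem1:
  fixes M :: "'w measure"
    and T :: nat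
    and \<alpha> \<beta> :: real
    and r :: "nat \<Rightarrow> 'm::finite \<Rightarrow> 'n::finite \<Rightarrow> real"
    and D :: "nat \<Rightarrow> 'w \<Rightarrow> real ^ 'm"
    and S :: "nat \<Rightarrow> 'w \<Rightarrow> real ^ 'n"
  assumes "dynamic_matching M T \<alpha> \<beta> r D S"
    and "dynamic_matching.modified_Monge T \<alpha> \<beta> r"
  shows "\<exists>q. dynamic_matching.optimal_policy M T \<alpha> \<beta> r D S q \<and>
             dynamic_matching.respects_dominance T \<alpha> \<beta> r q"
  using assms by (rule dynamic_matching.optimal_respecting_policy)

end
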